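(* Let $A=\{a_i : i\in\mathbb{N}\}\subseteq\mathbb{N}$ be an infinite set of natural numbers such that $a_i<a_{i+1}$ for all $i\in\mathbb{N}$ and $\liminf_{n\to\infty}\frac{a_{n+1}}{a_n}>1$. Then there exists a set $B\subseteq\mathbb{N}$ with density zero, $d(B)=0$, such that $B$ is an additive complement of $A$ in the complement of $A$.
   Context: $\mathbb{N}=\{1,2,3,\dots\}$ is the set of natural numbers. For $A,B\subseteq\mathbb{N}$, $A+B:=\{x+y: x\in A,\ y\in B\}$. A set $B\subseteq\mathbb{N}$ is an additive complement of $A\subseteq\mathbb{N}$ if $\mathbb{N}\setminus(A+B)$ is a finite set. A set $B\subseteq\mathbb{N}$ is an additive complement of $A$ in the complement of $A$ if $B$ is an additive complement of $A$ and $B\cap A=\varnothing$. The density of $B\subseteq\mathbb{N}$ is $d(B)=\lim_{n\to\infty}\frac{|B\cap\{1,\dots,n\}|}{n}$ when this limit exists (i.e. when the corresponding limsup and liminf coincide). *)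

theory Defs
  imports "HOL-Analysis.Analysis" "HOL-Library.Set_Algebras"
begin

text \<open>
  The natural numbers of the source start at 1, so subsets of them are rendered as
  sets \<open>A \<subseteq> {1..}\<close> of type \<^typ>\<open>nat set\<close>. The sumset \<open>A + B\<close> is the one
  from \<^theory>\<open>HOL-Library.Set_Algebras\<close>.
\<close>

definition additive_complement :: "nat set \<Rightarrow> nat set \<Rightarrow> bool" where
  "additive_complement A B \<longleftrightarrow> A \<subseteq> {1..} \<and> B \<subseteq> {1..} \<and> finite ({1..} - (A + B))"

definition additive_complement_in_complement :: "nat set \<Rightarrow> nat set \<Rightarrow> bool" where
  "additive_complement_in_complement A B \<longleftrightarrow> additive_complement A B \<and> B \<inter> A = {}"

text \<open>
  \<open>has_density B d\<close> says that the limit defining the density of \<open>B\<close> exists and equals \<open>d\<close>.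
\<close>

definition has_density :: "nat set \<Rightarrow> real \<Rightarrow> bool" where
  "has_density B d \<longleftrightarrow> (\<lambda>n. real (card (B \<inter> {1..n})) / real n) \<longlonglongrightarrow> d"

end

(* Idea. By Baire there is a real \<theta> such that every arc of the circle contains f * \<theta> mod 1 for
   infinitely many f in A. Let C be the set of n outside A with n * \<theta> mod 1 in [0, e).
   For every n some f in A moves n * \<theta> into that short arc, and in fact two different f do;
   since the gaps of A tend to infinity, one of the two differences n - f avoids A when n is large,
   so C is an additive complement. On the other hand, if f_0, ..., f_{m-1} in A have
   f_j * \<theta> close to j/m mod 1, the translates C + f_j are pairwise disjoint, so C has upper density
   at most 1/m. Letting e tend to 0 slowly along the natural numbers gives B. *)

theory Submission
  imports Defs
begin

text \<open>Baire category: requiring some f in A with f >= N to bring \<open>f * \<theta>\<close>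
  into (p, q) modulo 1 defines an open dense set of \<open>\<theta>\<close>. Rational p < q and
  natural N give only countably many such sets, so some \<open>\<theta>\<close> lies in all of them;
  letting N grow gives infinitely many f.\<close>

lemma exists_infinitely_dense_multiples:
  fixes A :: "nat set"
  assumes "infinite A"
  shows "\<exists>\<theta>::real. \<forall>p q. p < q \<longrightarrow>
    infinite {f \<in> A. \<exists>z::int. p < real f * \<theta> - z \<and> real f * \<theta> - z < q}"
proof -
  define U where "U = (\<lambda>(p::rat, q::rat, N::nat).
    (\<Union>f\<in>{f \<in> A. f \<ge> N}. \<Union>z::int. {\<theta>::real. of_rat p < real f * \<theta> - z} \<inter> {\<theta>. real f * \<theta> - z < of_rat q}))"
  define \<G> where "\<G> = U ` {(p, q, N). p < q}"
  have op: "open (U t)" for t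
  proof (cases t)
    case (fields p q N)
    show ?thesis
      unfolding U_def fields prod.case
      by (intro open_UN ballI open_Int open_Collect_less continuous_intros)
  qed
  have dense: "\<exists>\<theta>\<in>U (p, q, N). dist \<theta> x < e" if pq: "p < q" and e: "e > 0" for p q N x e
  proof -
    \<comment> \<open>Once \<open>f * e > 1\<close>, moving \<open>\<theta>\<close> by less than e
      moves \<open>f * \<theta>\<close> through a full turn of the circle, so every residue is
      reached near x.\<close>
    obtain K :: nat where K: "real K * e > 1"
      using e reals_Archimedean3 by blast
    obtain f where f: "f \<in> A" "f \<ge> Suc (max N K)"
      using assms by (meson finite_nat_set_iff_bounded_le nle_le)
    then have f0: "real f > 0" by simp
    have "real K * e \<le> real f * e"
      using f e by (intro mult_right_mono) auto
    then have fe: "real f * e > 1" using K by linarith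
    define c :: real where "c = (of_rat p + of_rat q) / 2"
    have c: "of_rat p < c" "c < of_rat q"
      using pq by (auto simp: c_def of_rat_less)
    \<comment> \<open>This z puts c + z in the half-open interval from f x (excluded) to f x + 1, so
      the \<open>\<theta>\<close> below is within 1/f of x.\<close>
    define z :: int where "z = \<lfloor>real f * x - c\<rfloor> + 1"
    define \<theta> where "\<theta> = (c + z) / real f"
    have f\<theta>: "real f * \<theta> = c + z" using f0 by (simp add: \<theta>_def)
    have "\<theta> \<in> U (p, q, N)"
      unfolding U_def using f c f\<theta> by (auto intro!: exI[of _ f] exI[of _ z])
    moreover have "real f * \<bar>\<theta> - x\<bar> = \<bar>c + z - real f * x\<bar>"
      using f0 f\<theta> by (metis abs_mult abs_of_pos right_diff_distrib)
    moreover have "\<bar>c + z - real f * x\<bar> \<le> 1"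
      unfolding z_def by linarith
    ultimately have "\<theta> \<in> U (p, q, N)" "real f * \<bar>\<theta> - x\<bar> < real f * e"
      using fe by auto
    then show ?thesis using f0 by (auto simp: dist_real_def)
  qed
  have "UNIV \<subseteq> closure (\<Inter>\<G>)"
  proof (rule Baire)
    show "countable \<G>" by (simp add: \<G>_def)
    show "openin (top_of_set UNIV) T \<and> UNIV \<subseteq> closure T" if "T \<in> \<G>" for T
      using that op dense by (auto simp: \<G>_def closure_approachable)
  qed auto
  then have "\<Inter>\<G> \<noteq> {}" by (metis closure_empty empty_not_UNIV subset_empty)
  then obtain \<theta> where \<theta>: "\<theta> \<in> \<Inter>\<G>" by blast
  have "infinite {f \<in> A. \<exists>z::int. p < real f * \<theta> - z \<and> real f * \<theta> - z < q}" if "p < q" for p q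
  proof -
    obtain r where r: "p < of_rat r" "of_rat r < q"
      using of_rat_dense[OF \<open>p < q\<close>] by blast
    obtain s where s: "of_rat r < (of_rat s :: real)" "of_rat s < q"
      using of_rat_dense[OF r(2)] by blast
    have rs: "r < s" using s by (simp add: of_rat_less)
    have "\<exists>f\<ge>N. f \<in> {f \<in> A. \<exists>z::int. p < real f * \<theta> - z \<and> real f * \<theta> - z < q}" for N
    proof -
      have "\<theta> \<in> U (r, s, N)" using \<theta> rs by (auto simp: \<G>_def)
      then obtain f z where "f \<in> A" "f \<ge> N" "of_rat r < real f * \<theta> - of_int z" "real f * \<theta> - of_int z < of_rat s"
        by (auto simp: U_def)
      then show ?thesis
        using r s by (intro exI[of _ f]) (auto intro!: exI[of _ z])
    qed
    then show ?thesis by (simp add: infinite_nat_iff_unbounded_le)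
  qed
  then show ?thesis by blast
qed

text \<open>For \<open>e \<le> 1\<close> this says that the fractional part of
  \<open>n * \<theta>\<close> is below e. With an integer witness in place of \<open>frac\<close>,
  residues add and subtract simply by adding and subtracting witnesses.\<close>

definition bohr_set :: "real \<Rightarrow> real \<Rightarrow> nat set" where
  "bohr_set \<theta> e = {n. \<exists>z::int. 0 \<le> real n * \<theta> - z \<and> real n * \<theta> - z < e}"

lemma bohr_set_mono: "d \<le> e \<Longrightarrow> bohr_set \<theta> d \<subseteq> bohr_set \<theta> e"
  unfolding bohr_set_def by force

text \<open>The m shifted copies of the part of C up to n are pairwise disjoint and all fit into
  \<open>{1..n + L}\<close>.\<close>

lemma card_disjoint_translates_le:
  fixes C :: "nat set" and f :: "nat \<Rightarrow> nat"
  assumes "\<And>i j x y. \<lbrakk>i < m; j < m; x \<in> C; y \<in> C; x + f i = y + f j\<rbrakk> \<Longrightarrow> i = j"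
    and "\<And>i. i < m \<Longrightarrow> f i \<le> L"
  shows "m * card (C \<inter> {1..n}) \<le> n + L"
proof -
  have "card ({..<m} \<times> (C \<inter> {1..n})) \<le> card {1..n + L}"
  proof (rule card_inj_on_le)
    show "inj_on (\<lambda>(i, x). x + f i) ({..<m} \<times> (C \<inter> {1..n}))"
      using assms(1) by (auto simp: inj_on_def) (metis add_right_cancel)+
    show "(\<lambda>(i, x). x + f i) ` ({..<m} \<times> (C \<inter> {1..n})) \<subseteq> {1..n + L}"
      using assms(2) by (auto intro!: add_mono)
  qed simp
  then show ?thesis by simp
qed

lemma bohr_set_upper_density:
  fixes A :: "nat set"
  assumes dense: "\<And>p q. p < q \<Longrightarrow>
      infinite {f \<in> A. \<exists>z::int. p < real f * \<theta> - z \<and> real f * \<theta> - z < q}"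
    and "m > 0"
  shows "\<exists>L. \<forall>n. m * card (bohr_set \<theta> (1 / (2 * real m)) \<inter> {1..n}) \<le> n + L"
proof -
  \<comment> \<open>Two errors below e, one from the Bohr set and one from placing
    \<open>f i\<close> near i/m, then add up to less than the spacing 1/m.\<close>
  define e where "e = 1 / (2 * real m)"
  have e: "e > 0" "2 * e * m = 1" using \<open>m > 0\<close> by (auto simp: e_def)
  have "\<exists>f. \<exists>z::int. real i / m < real f * \<theta> - z \<and> real f * \<theta> - z < real i / m + e" for i :: nat
    using dense[of "real i / m" "real i / m + e"] e(1) not_finite_existsD by fastforce
  then obtain f :: "nat \<Rightarrow> nat" and z :: "nat \<Rightarrow> int"
    where fz: "\<And>i. real i / m < real (f i) * \<theta> - z i" "\<And>i. real (f i) * \<theta> - z i < real i / m + e"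
    by metis
  have "m * card (bohr_set \<theta> e \<inter> {1..n}) \<le> n + (\<Sum>i<m. f i)" for n
  proof (rule card_disjoint_translates_le)
    fix i j x y
    assume ij: "i < m" "j < m" and xy: "x \<in> bohr_set \<theta> e" "y \<in> bohr_set \<theta> e" "x + f i = y + f j"
    obtain u v :: int where uv: "0 \<le> real x * \<theta> - u" "real x * \<theta> - u < e"
        "0 \<le> real y * \<theta> - v" "real y * \<theta> - v < e"
      using xy by (auto simp: bohr_set_def)
    have "real x * \<theta> + real (f i) * \<theta> = real y * \<theta> + real (f j) * \<theta>"
      using xy(3) by (metis distrib_right of_nat_add)
    \<comment> \<open>The two Bohr errors differ by less than e, and so do the two errors of
      \<open>f i\<close> and \<open>f j\<close>. Multiplied by m, the left side becomes an integer
      of absolute value below 1, hence 0.\<close>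
    then have "\<bar>real i / m - real j / m + (z i + u - z j - v)\<bar> < 2 * e"
      using fz[of i] fz[of j] uv by simp
    then have "\<bar>real i / m - real j / m + (z i + u - z j - v)\<bar> * m < 2 * e * m"
      using \<open>m > 0\<close> by (intro mult_strict_right_mono) auto
    also have "\<bar>real i / m - real j / m + (z i + u - z j - v)\<bar> * m
        = \<bar>(real i / m - real j / m + (z i + u - z j - v)) * m\<bar>"
      by (simp add: abs_mult)
    also have "(real i / m - real j / m + (z i + u - z j - v)) * m
        = real_of_int (int i - int j + (z i + u - z j - v) * int m)"
      using \<open>m > 0\<close> by (simp add: field_simps)
    finally have "int i - int j + (z i + u - z j - v) * int m = 0"
      using e(2) by linarith
    then have "int m dvd int i - int j"
      by (metis add_eq_0_iff dvd_minus_iff dvd_triv_right)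
    moreover have "\<bar>int i - int j\<bar> < int m" using ij by linarith
    ultimately show "i = j"
      using zdvd_not_zless[of "\<bar>int i - int j\<bar>" "int m"] by (cases "i = j") auto
  qed (simp add: member_le_sum)
  then show ?thesis unfolding e_def by blast
qed

text \<open>Cutting the circle into m arcs of length 1/m leaves finitely many shifts
  \<open>f i\<close>, \<open>g i\<close> to choose. One bound L therefore serves every n, and the
  gap condition can be applied with this L.\<close>

lemma bohr_set_complement:
  fixes A :: "nat set"
  assumes dense: "\<And>p q. p < q \<Longrightarrow>
      infinite {f \<in> A. \<exists>z::int. p < real f * \<theta> - z \<and> real f * \<theta> - z < q}"
    and gaps: "\<And>L. \<exists>G. \<forall>x\<in>A. \<forall>y\<in>A. G \<le> x \<and> x < y \<longrightarrow> L < y - x"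
    and A: "A \<subseteq> {1..}"
    and "e > 0"
  shows "additive_complement_in_complement A ({1..} \<inter> bohr_set \<theta> e - A)"
proof -
  obtain m :: nat where m: "m > 0" "1 / real m < e / 2"
    using \<open>e > 0\<close> by (metis half_gt_zero nat_approx_posE of_nat_Suc zero_less_Suc)
  \<comment> \<open>This is the arc just behind [i/m, (i+1)/m). If \<open>n * \<theta>\<close> lies
    in the latter, subtracting an element of \<open>S i\<close> leaves a residue strictly between 0
    and 2/m, and 2/m < e.\<close>
  define S where "S i = {f \<in> A. \<exists>z::int. (real i - 1) / m < real f * \<theta> - z \<and> real f * \<theta> - z < real i / m}" for i :: nat
  have "\<exists>f g. f \<in> S i \<and> g \<in> S i \<and> f < g" for i
  proof -
    have "infinite (S i)"
      unfolding S_def using m by (intro dense) (simp add: divide_strict_right_mono)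
    then show ?thesis
      by (metis finite_nat_set_iff_bounded not_less_iff_gr_or_eq infinite_imp_nonempty
          equals0I infinite_nat_iff_unbounded)
  qed
  then obtain f g where fg: "\<And>i. f i \<in> S i" "\<And>i. g i \<in> S i" "\<And>i. f i < g i" by metis
  define L where "L = (\<Sum>i<m. g i)"
  have gL: "g i \<le> L" if "i < m" for i
    unfolding L_def using that by (intro member_le_sum) auto
  obtain G where G: "\<And>x y. \<lbrakk>x \<in> A; y \<in> A; G \<le> x; x < y\<rbrakk> \<Longrightarrow> L < y - x"
    using gaps by metis
  have "n \<in> A + ({1..} \<inter> bohr_set \<theta> e - A)" if n: "n > L + G" for n
  proof -
    define t where "t = frac (real n * \<theta>)"
    define i where "i = nat \<lfloor>t * m\<rfloor>"
    have t: "0 \<le> t" "t < 1" by (auto simp: t_def frac_lt_1)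
    have "t * m < m" using t m by simp
    then have im: "i < m"
      using t by (simp add: i_def floor_less_iff nat_less_iff)
    have "real i \<le> t * m" "t * m < real i + 1"
      using t by (simp_all add: i_def)
    then have it: "real i / m \<le> t" "t < (real i + 1) / m"
      using m by (auto simp: field_simps)
    have bohr: "n - h \<in> bohr_set \<theta> e" if h: "h \<in> S i" "h \<le> n" for h
    proof -
      obtain z :: int where z: "(real i - 1) / m < real h * \<theta> - z" "real h * \<theta> - z < real i / m"
        using h by (auto simp: S_def)
      have "real (n - h) * \<theta> - real_of_int (\<lfloor>real n * \<theta>\<rfloor> - z) = t - (real h * \<theta> - z)"
        using h by (simp add: t_def frac_def of_nat_diff algebra_simps)
      moreover have "(real i + 1) / m = (real i - 1) / m + 2 / m"
        by (simp add: field_simps add_divide_distrib[symmetric])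
      moreover have "2 / m < e" using m(2) by simp
      ultimately have "0 \<le> real (n - h) * \<theta> - real_of_int (\<lfloor>real n * \<theta>\<rfloor> - z)"
        "real (n - h) * \<theta> - real_of_int (\<lfloor>real n * \<theta>\<rfloor> - z) < e"
        using z it by linarith+
      then show ?thesis
        unfolding bohr_set_def by blast
    qed
    \<comment> \<open>Otherwise A would have two elements above G at distance
      \<open>g i - f i\<close>, which is at most L.\<close>
    have "n - f i \<notin> A \<or> n - g i \<notin> A"
      using G[of "n - g i" "n - f i"] fg(3)[of i] gL[OF im] n by force
    then obtain h where h: "h \<in> S i" "h < n" "n - h \<notin> A"
      using fg[of i] gL[OF im] n by force
    then have "n - h \<in> {1..} \<inter> bohr_set \<theta> e - A" "h \<in> A" "n = h + (n - h)"
      using bohr[of h] by (auto simp: S_def)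
    then show ?thesis by (metis set_plus_intro)
  qed
  then have "{1..} - (A + ({1..} \<inter> bohr_set \<theta> e - A)) \<subseteq> {..L + G}"
    by (meson DiffD2 atMost_iff not_le subsetI)
  then have "finite ({1..} - (A + ({1..} \<inter> bohr_set \<theta> e - A)))"
    using finite_subset by blast
  then show ?thesis
    unfolding additive_complement_in_complement_def additive_complement_def using A by auto
qed

text \<open>B switches to the thinner set \<open>C k\<close> from the threshold \<open>N k\<close>
  on. It thus inherits the small density of every \<open>C k\<close>, while the thresholds are late
  enough for each n to be represented by the thinnest set active at n.\<close>

lemma diagonal_complement:
  fixes A :: "nat set" and C :: "nat \<Rightarrow> nat set"
  assumes "antimono C"
    and C: "\<And>k. additive_complement_in_complement A (C k)"
    and small: "\<And>e. e > 0 \<Longrightarrow>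
      \<exists>k. eventually (\<lambda>n. real (card (C k \<inter> {1..n})) \<le> e * real n) sequentially"
  shows "\<exists>B. has_density B 0 \<and> additive_complement_in_complement A B"
proof -
  have "\<exists>N. \<forall>n\<ge>N. n \<in> A + C k" for k
  proof -
    have "finite ({1..} - (A + C k))"
      using C by (simp add: additive_complement_in_complement_def additive_complement_def)
    then obtain M where M: "\<forall>n\<in>{1..} - (A + C k). n \<le> M"
      using finite_nat_set_iff_bounded_le by blast
    have "n \<in> A + C k" if "n \<ge> Suc M" for n
      using bspec[OF M, of n] that by (cases "n \<in> A + C k") auto
    then show ?thesis by blast
  qed
  then obtain M where M: "\<And>k n. n \<ge> M k \<Longrightarrow> n \<in> A + C k" by metis
  \<comment> \<open>Taking the maximum with k leaves only finitely many thresholds below a given n,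
    so a largest active index exists.\<close>
  define N where "N k = max k (M k)" for k
  define B where "B = {b \<in> C 0. \<forall>k. N k \<le> b \<longrightarrow> b \<in> C k}"
  have "n \<in> A + B" if "n \<ge> N 0" for n
  proof -
    define K where "K = {k. N k \<le> n}"
    have fin: "finite K"
      by (rule finite_subset[of _ "{..n}"]) (auto simp: K_def N_def)
    have "0 \<in> K" using that by (simp add: K_def)
    then have "Max K \<in> K" using fin Max_in by blast
    then have "n \<ge> M (Max K)" by (simp add: K_def N_def)
    then obtain x b where xb: "x \<in> A" "b \<in> C (Max K)" "n = x + b"
      using M by (meson set_plus_elim)
    have "b \<in> C k" if "k \<in> K" for k
      using xb(2) antimonoD[OF \<open>antimono C\<close> Max_ge[OF fin that]] by blast
    \<comment> \<open>As \<open>b \<le> n\<close>, every k with \<open>N k \<le> b\<close> is in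
      K.\<close>
    then have "b \<in> B" using \<open>0 \<in> K\<close> xb(3) by (auto simp: B_def K_def)
    then show ?thesis using xb by auto
  qed
  then have "{1..} - (A + B) \<subseteq> {..N 0}" by (meson DiffD2 atMost_iff nle_le subsetI)
  then have "finite ({1..} - (A + B))" using finite_subset by blast
  moreover have "B \<subseteq> C 0" by (auto simp: B_def)
  ultimately have "additive_complement_in_complement A B"
    using C[of 0] by (auto simp: additive_complement_in_complement_def additive_complement_def)
  moreover have "has_density B 0"
    unfolding has_density_def
  proof (rule LIMSEQ_I)
    fix r :: real assume "r > 0"
    \<comment> \<open>One third of r pays for \<open>C k\<close>, another for the initial segment up
      to \<open>N k\<close>; the remaining third makes the bound strict.\<close>
    then obtain k where k: "eventually (\<lambda>n. real (card (C k \<inter> {1..n})) \<le> r / 3 * real n) sequentially"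
      using small[of "r / 3"] by auto
    obtain P where P: "\<And>n. n \<ge> P \<Longrightarrow> real (card (C k \<inter> {1..n})) \<le> r / 3 * real n"
      using k by (auto simp: eventually_sequentially)
    obtain Q :: nat where Q: "real Q * (r / 3) > real (N k)"
      using reals_Archimedean3[of "r / 3"] \<open>r > 0\<close> by auto
    have "norm (real (card (B \<inter> {1..n})) / real n - 0) < r" if n: "n \<ge> Suc (max P Q)" for n
    proof -
      have "B \<inter> {1..n} \<subseteq> C k \<inter> {1..n} \<union> {1..N k}"
        by (auto simp: B_def)
      then have "card (B \<inter> {1..n}) \<le> card (C k \<inter> {1..n} \<union> {1..N k})"
        by (intro card_mono) auto
      also have "\<dots> \<le> card (C k \<inter> {1..n}) + N k"
        using card_Un_le[of "C k \<inter> {1..n}" "{1..N k}"] by simp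
      finally have "real (card (B \<inter> {1..n})) \<le> real (card (C k \<inter> {1..n})) + real (N k)"
        by (metis of_nat_add of_nat_mono)
      also have "\<dots> < r / 3 * real n + real Q * (r / 3)"
        using P[of n] Q n by (intro add_le_less_mono) auto
      also have "real Q * (r / 3) \<le> real n * (r / 3)"
        using n \<open>r > 0\<close> by (intro mult_right_mono) auto
      finally have "real (card (B \<inter> {1..n})) < r * real n"
        using mult_pos_pos[of r "real n"] \<open>r > 0\<close> n by (simp add: field_simps)
      then show ?thesis using n by (simp add: divide_less_eq)
    qed
    then show "\<exists>no. \<forall>n\<ge>no. norm (real (card (B \<inter> {1..n})) / real n - 0) < r" by blast
  qed
  ultimately show ?thesis by blast
qed

text \<open>For a real q > 1 below the liminf, consecutive terms eventually differ by more than (q -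
  1) times the smaller one, which tends to infinity.\<close>

lemma lacunary_gaps_tend_to_infinity:
  fixes a :: "nat \<Rightarrow> nat"
  assumes inc: "\<And>i. i \<ge> 1 \<Longrightarrow> a i < a (i + 1)"
    and lim: "liminf (\<lambda>n. ereal (real (a (n + 1)) / real (a n))) > 1"
  shows "\<exists>G. \<forall>i\<ge>1. \<forall>j\<ge>1. G \<le> a i \<and> a i < a j \<longrightarrow> L < a j - a i"
proof -
  have less: "a i < a j" if "1 \<le> i" "i < j" for i j
    using \<open>i < j\<close>
  proof (induction j)
    case (Suc j)
    then show ?case
      using inc[of j] \<open>1 \<le> i\<close> by (cases "i = j") auto
  qed simp
  obtain q where q: "1 < ereal q" "ereal q < liminf (\<lambda>n. ereal (real (a (n + 1)) / real (a n)))"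
    using lim ereal_dense2 by blast
  obtain I where I: "\<And>n. n \<ge> I \<Longrightarrow> q < real (a (n + 1)) / real (a n)"
    using less_LiminfD[OF q(2)] by (auto simp: eventually_sequentially)
  obtain M :: nat where M: "real M * (q - 1) > real L"
    using reals_Archimedean3[of "q - 1"] q by auto
  \<comment> \<open>In the threshold, \<open>a (Suc I)\<close> forces \<open>i \<ge> I\<close>, M
    makes (q - 1) \<open>a i\<close> exceed L, and 1 makes \<open>a i\<close> positive for the
    division.\<close>
  have "L < a j - a i" if ij: "i \<ge> 1" "j \<ge> 1" "a (Suc I) + M + 1 \<le> a i" "a i < a j" for i j
  proof -
    have "i \<ge> I" using less[of i "Suc I"] ij by (metis Suc_n_not_le_n add_leD1 leD le_SucI linorder_le_cases nat_less_le)
    then have "q * real (a i) < real (a (i + 1))"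
      using I[of i] ij by (simp add: pos_less_divide_eq)
    moreover have "a (i + 1) \<le> a j"
      using less[of j i] less[of "i + 1" j] ij by (metis Suc_eq_plus1 le_add2 less_or_eq_imp_le not_less_eq not_less_iff_gr_or_eq)
    moreover have "real M * (q - 1) \<le> real (a i) * (q - 1)"
      using ij q by (intro mult_right_mono) auto
    ultimately have "real L < real (a j) - real (a i)"
      using M by (simp add: algebra_simps)
    then show ?thesis using ij by linarith
  qed
  then show ?thesis by blast
qed

theorem theorem2p1:
  fixes A :: "nat set" and a :: "nat \<Rightarrow> nat"
  assumes "A \<subseteq> {1..}"
    and "infinite A"
    and "A = {a i | i. i \<ge> 1}"
    and "\<And>i. i \<ge> 1 \<Longrightarrow> a i < a (i + 1)"
    and "liminf (\<lambda>n. ereal (real (a (n + 1)) / real (a n))) > 1"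
  shows "\<exists>B. B \<subseteq> {1..} \<and> has_density B 0 \<and> additive_complement_in_complement A B"
proof -
  obtain \<theta> :: real where \<theta>: "\<And>p q. p < q \<Longrightarrow>
      infinite {f \<in> A. \<exists>z::int. p < real f * \<theta> - z \<and> real f * \<theta> - z < q}"
    using exists_infinitely_dense_multiples[OF assms(2)] by blast
  have gaps: "\<exists>G. \<forall>x\<in>A. \<forall>y\<in>A. G \<le> x \<and> x < y \<longrightarrow> L < y - x" for L
    using lacunary_gaps_tend_to_infinity[OF assms(4,5), of L] unfolding assms(3) by blast
  \<comment> \<open>The width is the one in \<open>bohr_set_upper_density\<close> with m = k +
    1.\<close>
  define C where "C k = {1..} \<inter> bohr_set \<theta> (1 / (2 * real (Suc k))) - A" for k
  have "\<exists>B. has_density B 0 \<and> additive_complement_in_complement A B"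
  proof (rule diagonal_complement)
    show "antimono C"
    proof (rule antimonoI)
      fix j k :: nat assume "j \<le> k"
      then have "bohr_set \<theta> (1 / (2 * real (Suc k))) \<subseteq> bohr_set \<theta> (1 / (2 * real (Suc j)))"
        by (intro bohr_set_mono frac_le) auto
      then show "C k \<subseteq> C j" by (auto simp: C_def)
    qed
    show "additive_complement_in_complement A (C k)" for k
      unfolding C_def by (rule bohr_set_complement[OF \<theta> gaps assms(1)]) auto
    show "\<exists>k. eventually (\<lambda>n. real (card (C k \<inter> {1..n})) \<le> e * real n) sequentially"
      if e: "e > 0" for e
    proof -
      \<comment> \<open>The factor 2 absorbs the constant L, since \<open>n + L \<le> 2 * n\<close>
        once \<open>n \<ge> L\<close>.\<close>
      obtain k where k: "1 / real (Suc k) < e / 2"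
        using e by (metis half_gt_zero nat_approx_posE)
      obtain L where L: "\<And>n. Suc k * card (bohr_set \<theta> (1 / (2 * real (Suc k))) \<inter> {1..n}) \<le> n + L"
        using bohr_set_upper_density[OF \<theta>, of "Suc k"] by blast
      have "real (card (C k \<inter> {1..n})) \<le> e * real n" if n: "n \<ge> L" for n
      proof -
        have "card (C k \<inter> {1..n}) \<le> card (bohr_set \<theta> (1 / (2 * real (Suc k))) \<inter> {1..n})"
          by (intro card_mono) (auto simp: C_def)
        then have "Suc k * card (C k \<inter> {1..n}) \<le> 2 * n"
          using L[of n] n mult_le_mono2[of _ _ "Suc k"] by (smt (verit) add_mono le_trans mult_2 order_refl)
        then have "real (Suc k) * real (card (C k \<inter> {1..n})) \<le> 2 * real n"
          by (metis of_nat_le_iff of_nat_mult of_nat_numeral)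
        then have "real (card (C k \<inter> {1..n})) \<le> 1 / real (Suc k) * (2 * real n)"
          by (simp add: field_simps)
        also have "\<dots> \<le> e / 2 * (2 * real n)"
          using k by (intro mult_right_mono) auto
        finally show ?thesis by simp
      qed
      then show ?thesis unfolding eventually_sequentially by blast
    qed
  qed
  then show ?thesis
    by (auto simp: additive_complement_in_complement_def additive_complement_def)
qed

end
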